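(* Let $T=\{(x,y)\in\mathbb{R}^2: 0\leq x\leq1,\ 0\leq y\leq x\}$ and let $\varepsilon>0$. Let $\mathcal{S}$ be a countable collection of squares $S$, each with sides parallel to the coordinate axes and with $S\subset T$. If $m\left(\bigcup_{S\in\mathcal{S}}S\right)\geq\frac{1-\varepsilon}{2}$, then $\sum_{S\in\mathcal{S}}\ell(S)\geq\frac12\log\frac1\varepsilon$. In particular, if $\bigcup_{S\in\mathcal{S}}S$ contains almost all points of $T$ (all but a set of measure zero), then $\sum_{S\in\mathcal{S}}\ell(S)$ diverges.
   Context: $m$ denotes two-dimensional Lebesgue measure, logarithms are to base $2$, and $\ell(S)$ denotes the side length of a square $S$. *)

theory Defs
  imports "HOL-Analysis.Analysis"
begin

definition lower_triangle :: "(real \<times> real) set" where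
  "lower_triangle = {(x, y). 0 \<le> x \<and> x \<le> 1 \<and> 0 \<le> y \<and> y \<le> x}"

text \<open>
  Squares are closed and nondegenerate. Since the triangle is closed, replacing a square that
  omits boundary points by its closure keeps it inside the triangle and preserves its side length.
\<close>

definition aligned_square :: "real \<Rightarrow> real \<Rightarrow> real \<Rightarrow> (real \<times> real) set" where
  "aligned_square a b l = {a..a + l} \<times> {b..b + l}"

definition is_aligned_square :: "(real \<times> real) set \<Rightarrow> bool" where
  "is_aligned_square S \<longleftrightarrow> (\<exists>a b l. 0 < l \<and> S = aligned_square a b l)"

definition side_length :: "(real \<times> real) set \<Rightarrow> real" where
  "side_length S = (THE l. 0 < l \<and> (\<exists>a b. S = aligned_square a b l))"

lemma side_length_aligned_square:
  assumes "0 < l"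
  shows "side_length (aligned_square a b l) = l"
  unfolding side_length_def
proof (rule the_equality)
  show "0 < l \<and> (\<exists>a' b'. aligned_square a b l = aligned_square a' b' l)"
    using assms by blast
next
  fix l' assume "0 < l' \<and> (\<exists>a' b'. aligned_square a b l = aligned_square a' b' l')"
  then obtain a' b' where l': "0 < l'"
    and eq: "{a..a + l} \<times> {b..b + l} = {a'..a' + l'} \<times> {b'..b' + l'}"
    by (auto simp: aligned_square_def)
  have "{a..a + l} = {a'..a' + l'}"
    using arg_cong[OF eq, of "image fst"] assms l' by simp
  then show "l' = l"
    using assms l' by (simp add: Icc_eq_Icc)
qed

end

theory Submission
  imports Defs "HOL-Probability.Probability_Measure"
begin

text \<open>
  A square \<open>A \<times> B\<close> below the diagonal is a complete bipartite graph between two disjoint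
  subintervals of \<open>[0, 1]\<close>, and the argument is Hansel's for covering a complete graph by
  bipartite graphs. For each square independently delete either \<open>A\<close> or \<open>B\<close> with probability
  one half. A point lying in \<open>d(x)\<close> of the sides survives with probability \<open>2\<close> to the power
  \<open>-d(x)\<close>, and no two survivors form a covered pair. If \<open>N(x)\<close> is the measure of the set of
  points not joined to \<open>x\<close>, then \<open>N \<ge> |X|\<close> on every surviving set \<open>X\<close>, so the integral of
  \<open>1 / N\<close> over \<open>X\<close> is at most \<open>1\<close>. Taking expectations, the integral of \<open>2\<^bsup>-d\<^esup> / N\<close> is at most
  \<open>1\<close>, and two applications of Jensen's inequality for the logarithm bound the integral of
  \<open>d\<close>, which is twice the sum of the side lengths, from below.
\<close>

section \<open>Survival probabilities under random deletion\<close>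

text \<open>Here \<open>C\<close> is the set of indices whose \<open>A\<close> side is deleted; the
  others lose \<open>B\<close>. Each factor is the average of the survival indicators for the two
  options, so expanding the product averages over all choices of \<open>C\<close>.\<close>

lemma prod_deletion_weights:
  fixes A B :: "'i \<Rightarrow> 'a set"
  assumes "finite I"
  shows "(\<Prod>i\<in>I. 1 - (indicator (A i) x + indicator (B i) x) / 2 :: real) =
    (1 / 2) ^ card I *
      (\<Sum>C\<in>Pow I. indicator {x. (\<forall>i\<in>C. x \<notin> A i) \<and> (\<forall>i\<in>I - C. x \<notin> B i)} x)"
proof -
  have ind: "(\<Prod>i\<in>J. 1 - indicator (D i) x :: real) = indicator {x. \<forall>i\<in>J. x \<notin> D i} x"
    if "finite J" for J :: "'i set" and D
    using that by (induction J) (auto simp: indicator_def)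
  have "(\<Prod>i\<in>I. 1 - (indicator (A i) x + indicator (B i) x) / 2 :: real) =
      (\<Prod>i\<in>I. (1 / 2) * ((1 - indicator (A i) x) + (1 - indicator (B i) x)))"
    by (simp add: field_simps)
  also have "\<dots> = (1 / 2) ^ card I * (\<Sum>C\<in>Pow I.
      (\<Prod>i\<in>C. 1 - indicator (A i) x) * (\<Prod>i\<in>I - C. 1 - indicator (B i) x))"
    by (simp only: prod.distrib prod_constant prod_add[OF \<open>finite I\<close>])
  also have "(\<Sum>C\<in>Pow I. (\<Prod>i\<in>C. 1 - indicator (A i) x) * (\<Prod>i\<in>I - C. 1 - indicator (B i) x)) =
      (\<Sum>C\<in>Pow I. indicator {x. (\<forall>i\<in>C. x \<notin> A i) \<and> (\<forall>i\<in>I - C. x \<notin> B i)} x :: real)"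
  proof (rule sum.cong[OF refl])
    fix C assume "C \<in> Pow I"
    then have "finite C" "finite (I - C)"
      using \<open>finite I\<close> finite_subset by auto
    then show "(\<Prod>i\<in>C. 1 - indicator (A i) x) * (\<Prod>i\<in>I - C. 1 - indicator (B i) x) =
      (indicator {x. (\<forall>i\<in>C. x \<notin> A i) \<and> (\<forall>i\<in>I - C. x \<notin> B i)} x :: real)"
      by (simp only: ind) (auto simp: indicator_def)
  qed
  finally show ?thesis .
qed

text \<open>By disjointness at most one of the two indicators is 1, so each factor is 1 or 1/2, and
  the logarithm counts the sides that contain \<open>x\<close>.\<close>

lemma ln_prod_deletion_weights:
  fixes A B :: "'i \<Rightarrow> 'a set"
  assumes "finite I" and disj: "\<And>i. i \<in> I \<Longrightarrow> A i \<inter> B i = {}"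
  defines "q \<equiv> (\<lambda>x. \<Prod>i\<in>I. 1 - (indicator (A i) x + indicator (B i) x) / 2 :: real)"
  shows "0 < q x"
    and "ln (q x) = - ln 2 * (\<Sum>i\<in>I. indicator (A i) x + indicator (B i) x)"
proof -
  have factor: "0 < 1 - (indicator (A i) x + indicator (B i) x) / (2 :: real)"
      "ln (1 - (indicator (A i) x + indicator (B i) x) / (2 :: real)) =
        - ln 2 * (indicator (A i) x + indicator (B i) x)" if "i \<in> I" for i
    using disj[OF that] by (auto simp: indicator_def ln_div)
  show "0 < q x"
    unfolding q_def by (intro prod_pos factor ballI)
  have "ln (q x) = (\<Sum>i\<in>I. ln (1 - (indicator (A i) x + indicator (B i) x) / 2))"
    unfolding q_def using \<open>finite I\<close> factor(1) by (intro ln_prod) (auto simp: less_imp_neq[symmetric])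
  also have "\<dots> = (\<Sum>i\<in>I. - ln 2 * (indicator (A i) x + indicator (B i) x))"
    by (intro sum.cong refl factor)
  finally show "ln (q x) = - ln 2 * (\<Sum>i\<in>I. indicator (A i) x + indicator (B i) x)"
    by (simp only: sum_distrib_left)
qed

section \<open>Bipartite covers of a probability space\<close>

text \<open>\<open>W\<close> contains every pair joined by none of the graphs. The strict bound by
  \<open>K\<close> leaves a slack that keeps denominators positive even where the sections of
  \<open>W\<close> are null.\<close>

lemma (in prob_space) biclique_cover_lower_bound:
  fixes A B :: "'i \<Rightarrow> 'a set" and K :: real
  assumes I: "finite I"
    and A: "\<And>i. i \<in> I \<Longrightarrow> A i \<in> sets M" and B: "\<And>i. i \<in> I \<Longrightarrow> B i \<in> sets M"
    and disj: "\<And>i. i \<in> I \<Longrightarrow> A i \<inter> B i = {}"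
    and W: "W \<in> sets (M \<Otimes>\<^sub>M M)"
    and uncovered: "\<And>x y. x \<in> space M \<Longrightarrow> y \<in> space M \<Longrightarrow>
      (\<And>i. i \<in> I \<Longrightarrow> \<not> (x \<in> A i \<and> y \<in> B i) \<and> \<not> (x \<in> B i \<and> y \<in> A i)) \<Longrightarrow> (x, y) \<in> W"
    and K: "measure (M \<Otimes>\<^sub>M M) W < K"
  shows "- ln K \<le> ln 2 * (\<Sum>i\<in>I. prob (A i) + prob (B i))"
proof -
  interpret P: pair_prob_space M M ..
  \<comment> \<open>Chosen so that \<open>N x + \<delta>\<close> has mean exactly
    \<open>K\<close>.\<close>
  define \<delta> where "\<delta> = K - measure (M \<Otimes>\<^sub>M M) W"
  have \<delta>: "0 < \<delta>" and K0: "0 < K"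
    using K le_less_trans[OF measure_nonneg K] by (simp_all add: \<delta>_def)
  define N where "N = (\<lambda>x. prob (Pair x -` W))"
  have N0: "0 \<le> N x" and N1: "N x \<le> 1" for x
    by (auto simp: N_def)
  have N_meas [measurable]: "N \<in> borel_measurable M"
    unfolding N_def measure_def using measurable_emeasure_Pair[OF W] by measurable
  have N_int: "integrable M N"
    by (rule integrable_const_bound[where B = 1]) (auto simp: N0 N1)
  have "ennreal (expectation N) = (\<integral>\<^sup>+x. ennreal (N x) \<partial>M)"
    using N_int N0 by (simp add: nn_integral_eq_integral)
  also have "\<dots> = ennreal (measure (M \<Otimes>\<^sub>M M) W)"
    by (simp add: N_def emeasure_eq_measure[symmetric] P.emeasure_eq_measure[symmetric]
        emeasure_pair_measure_alt[OF W])
  finally have N_expect: "expectation N = measure (M \<Otimes>\<^sub>M M) W"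
    by (simp add: N0)

  define X where "X = (\<lambda>C. {x. (\<forall>i\<in>C. x \<notin> A i) \<and> (\<forall>i\<in>I - C. x \<notin> B i)} \<inter> space M)"
  have X_sets [measurable]: "X C \<in> sets M" if "C \<in> Pow I" for C
  proof -
    have "X C = space M - ((\<Union>i\<in>C. A i) \<union> (\<Union>i\<in>I - C. B i))"
      by (auto simp: X_def)
    moreover have "finite C" "finite (I - C)"
      using that I finite_subset by auto
    ultimately show ?thesis
      using that A B by (auto intro!: sets.Diff sets.Un sets.finite_UN)
  qed
  have X_int: "integrable M (\<lambda>x. indicator (X C) x / (N x + \<delta>))" if "C \<in> Pow I" for C
  proof (rule integrable_const_bound[where B = "1 / \<delta>"])
    show "(\<lambda>x. indicator (X C) x / (N x + \<delta>)) \<in> borel_measurable M"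
      using X_sets[OF that] by measurable
    show "AE x in M. norm (indicator (X C) x / (N x + \<delta>)) \<le> 1 / \<delta>"
      using \<delta> N0 by (auto simp: indicator_def frac_le abs_of_nonneg)
  qed
  have X_le: "expectation (\<lambda>x. indicator (X C) x / (N x + \<delta>)) \<le> 1" if C: "C \<in> Pow I" for C
  proof -
    \<comment> \<open>Every index has lost one side on \<open>X C\<close>, so no two points of
      \<open>X C\<close> are joined: the section of \<open>W\<close> at \<open>x\<close> contains
      all of \<open>X C\<close>.\<close>
    have N_ge: "prob (X C) \<le> N x" if x: "x \<in> X C" for x
      unfolding N_def
    proof (rule finite_measure_mono)
      show "Pair x -` W \<in> events" using W by (rule sets_Pair1)
      show "X C \<subseteq> Pair x -` W"
      proof
        fix y assume y: "y \<in> X C"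
        have "(x, y) \<in> W"
          using x y C by (intro uncovered) (auto simp: X_def)
        then show "y \<in> Pair x -` W" by simp
      qed
    qed
    have "expectation (\<lambda>x. indicator (X C) x / (N x + \<delta>)) \<le>
        expectation (\<lambda>x. indicator (X C) x / (prob (X C) + \<delta>))"
    proof (rule integral_mono[OF X_int[OF C]])
      show "integrable M (\<lambda>x. indicator (X C) x / (prob (X C) + \<delta>))"
        using X_sets[OF C] by (simp add: emeasure_eq_measure)
      show "indicator (X C) x / (N x + \<delta>) \<le> indicator (X C) x / (prob (X C) + \<delta>)" for x
        using N_ge[of x] \<delta> measure_nonneg[of M "X C"]
        by (auto simp: indicator_def intro!: divide_left_mono mult_pos_pos add_nonneg_pos N0)
    qed
    also have "\<dots> = prob (X C) / (prob (X C) + \<delta>)"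
      using X_sets[OF C] by (simp add: Int_absorb2 sets.sets_into_space)
    also have "\<dots> \<le> 1"
      using \<delta> add_nonneg_pos[OF measure_nonneg \<delta>, of M "X C"] by (simp only: divide_le_eq) simp
    finally show ?thesis .
  qed

  define q where "q = (\<lambda>x. \<Prod>i\<in>I. 1 - (indicator (A i) x + indicator (B i) x) / 2 :: real)"
  define d where "d = (\<lambda>x. \<Sum>i\<in>I. indicator (A i) x + indicator (B i) x :: real)"
  have q0: "0 < q x" and ln_q: "ln (q x) = - ln 2 * d x" for x
    using ln_prod_deletion_weights[of I A B x, OF I disj] by (simp_all add: q_def d_def)
  have q_eq: "q x / (N x + \<delta>) = (1 / 2) ^ card I * (\<Sum>C\<in>Pow I. indicator (X C) x / (N x + \<delta>))"
    if "x \<in> space M" for x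
  proof -
    have "q x = (1 / 2) ^ card I * (\<Sum>C\<in>Pow I. indicator (X C) x)"
      unfolding q_def prod_deletion_weights[OF I]
      using that by (simp add: X_def indicator_inter_arith)
    then show ?thesis by (simp add: sum_divide_distrib[symmetric])
  qed
  have q_int: "integrable M (\<lambda>x. q x / (N x + \<delta>))"
    using X_int by (subst Bochner_Integration.integrable_cong[OF refl q_eq]) auto
  have "expectation (\<lambda>x. q x / (N x + \<delta>)) =
      (1 / 2) ^ card I * (\<Sum>C\<in>Pow I. expectation (\<lambda>x. indicator (X C) x / (N x + \<delta>)))"
    using X_int by (subst Bochner_Integration.integral_cong[OF refl q_eq]) auto
  \<comment> \<open>There are \<open>2 ^ card I\<close> deletion choices, each contributing at most
    1, so their average is at most 1.\<close>
  also have "\<dots> \<le> (1 / 2) ^ card I * (\<Sum>C\<in>Pow I. 1)"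
    by (intro mult_left_mono sum_mono X_le) auto
  also have "\<dots> = 1"
    using I by (simp add: card_Pow power_divide)
  finally have q_le: "expectation (\<lambda>x. q x / (N x + \<delta>)) \<le> 1" .

  have d_int: "integrable M d"
    unfolding d_def using A B by (auto simp: emeasure_eq_measure)
  have d_expect: "expectation d = (\<Sum>i\<in>I. prob (A i) + prob (B i))"
    unfolding d_def using A B
    by (subst Bochner_Integration.integral_sum)
      (auto simp: emeasure_eq_measure Int_absorb2 sets.sets_into_space intro!: sum.cong)

  \<comment> \<open>Both uses of Jensen's inequality are tangent-line bounds \<open>ln t \<le> t - 1\<close>.\<close>
  have pointwise: "- ln 2 * d x \<le> q x / (N x + \<delta>) + (N x + \<delta>) / K - 2 + ln K" for x
  proof -
    have N\<delta>: "0 < N x + \<delta>" using N0[of x] \<delta> by simp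
    have "ln (q x / (N x + \<delta>)) \<le> q x / (N x + \<delta>) - 1"
      using q0[of x] N\<delta> by (intro ln_le_minus_one) simp
    moreover have "ln ((N x + \<delta>) / K) \<le> (N x + \<delta>) / K - 1"
      using K0 N\<delta> by (intro ln_le_minus_one) simp
    ultimately show ?thesis
      using q0[of x] N\<delta> K0 ln_q[of x] by (simp add: ln_div)
  qed
  have "- ln 2 * expectation d = expectation (\<lambda>x. - ln 2 * d x)"
    by simp
  also have "\<dots> \<le> expectation (\<lambda>x. q x / (N x + \<delta>) + (N x + \<delta>) / K - 2 + ln K)"
    using d_int q_int N_int by (intro integral_mono pointwise) auto
  also have "\<dots> = expectation (\<lambda>x. q x / (N x + \<delta>)) + (expectation N + \<delta>) / K - 2 + ln K"
    using q_int N_int by (simp add: prob_space)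
  \<comment> \<open>The second quotient is \<open>K / K\<close> by the choice of
    \<open>\<delta>\<close>, and the first expectation is at most 1, so together they cancel the
    2.\<close>
  also have "\<dots> \<le> ln K"
    using q_le K0 by (simp add: N_expect \<delta>_def)
  finally show ?thesis
    by (simp add: d_expect)
qed

section \<open>Lebesgue measure in the plane and continuity along unions\<close>

lemma sets_pair_restrict_lborel:
  fixes E :: "(real \<times> real) set"
  assumes "E \<in> sets borel" "E \<subseteq> Z \<times> Z"
  shows "E \<in> sets (restrict_space lborel Z \<Otimes>\<^sub>M restrict_space lborel Z)" (is "E \<in> sets ?MM")
proof -
  \<comment> \<open>The inclusion of \<open>Z \<times> Z\<close> in the plane is written by
    coordinates, so that its measurability reduces to that of the inclusion of \<open>Z\<close> in
    the line.\<close>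
  have "(\<lambda>p. (fst p, snd p)) \<in> ?MM \<rightarrow>\<^sub>M lborel \<Otimes>\<^sub>M lborel"
    by (intro measurable_Pair measurable_compose[OF measurable_fst]
      measurable_compose[OF measurable_snd] measurable_restrict_space1 measurable_ident_sets refl)
  moreover have "E \<in> sets (lborel \<Otimes>\<^sub>M lborel)"
    using assms by (simp only: lborel_prod sets_lborel)
  ultimately have "(\<lambda>p. (fst p, snd p)) -` E \<inter> space ?MM \<in> sets ?MM"
    by (rule measurable_sets)
  moreover have "(\<lambda>p. (fst p, snd p)) -` E \<inter> space ?MM = E"
    using assms(2) by (auto simp: space_pair_measure space_restrict_space)
  ultimately show ?thesis by simp
qed

text \<open>Sections of \<open>E\<close> lie in \<open>Z\<close> and are empty over points outside
  \<open>Z\<close>, so restricting the inner measure and the outer integral to \<open>Z\<close>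
  changes neither.\<close>

lemma emeasure_pair_restrict_lborel:
  fixes E :: "(real \<times> real) set"
  assumes "E \<in> sets borel" "Z \<in> sets borel" "E \<subseteq> Z \<times> Z"
    and "sigma_finite_measure (restrict_space lborel Z)"
  shows "emeasure (restrict_space lborel Z \<Otimes>\<^sub>M restrict_space lborel Z) E = emeasure lborel E"
proof -
  let ?M = "restrict_space lborel Z"
  have E: "E \<in> sets (lborel \<Otimes>\<^sub>M lborel)"
    using assms by (simp only: lborel_prod sets_lborel)
  have sec: "Pair x -` E \<subseteq> Z" for x
    using assms(3) by auto
  have "emeasure (?M \<Otimes>\<^sub>M ?M) E = (\<integral>\<^sup>+x. emeasure ?M (Pair x -` E) \<partial>?M)"
    by (intro sigma_finite_measure.emeasure_pair_measure_alt assms sets_pair_restrict_lborel)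
  also have "\<dots> = (\<integral>\<^sup>+x. emeasure lborel (Pair x -` E) \<partial>?M)"
    using assms(2) sec by (simp add: emeasure_restrict_space)
  also have "\<dots> = (\<integral>\<^sup>+x. emeasure lborel (Pair x -` E) * indicator Z x \<partial>lborel)"
    using assms(2) by (simp add: nn_integral_restrict_space)
  also have "\<dots> = (\<integral>\<^sup>+x. emeasure lborel (Pair x -` E) \<partial>lborel)"
  proof (intro nn_integral_cong)
    fix x
    show "emeasure lborel (Pair x -` E) * indicator Z x = emeasure lborel (Pair x -` E)"
    proof (cases "x \<in> Z")
      case False
      then have "Pair x -` E = {}" using assms(3) by auto
      then show ?thesis by simp
    qed simp
  qed
  also have "\<dots> = emeasure (lborel \<Otimes>\<^sub>M lborel) E"
    using lborel.emeasure_pair_measure_alt[OF E] by simp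
  finally show ?thesis
    by (simp add: lborel_prod)
qed

text \<open>The swap is continuous and exchanges two equal factors of the product measure.\<close>

lemma
  fixes E :: "(real \<times> real) set"
  assumes E: "E \<in> sets borel"
  shows sets_swap_borel: "prod.swap -` E \<in> sets borel"
    and emeasure_swap_lborel: "emeasure lborel (prod.swap -` E) = emeasure lborel E"
proof -
  have swap: "prod.swap \<in> borel_measurable (borel :: (real \<times> real) measure)"
    by (intro borel_measurable_continuous_onI) (simp add: prod.swap_def continuous_intros)
  show "prod.swap -` E \<in> sets borel"
    using measurable_sets[OF swap E] by simp
  have "emeasure lborel E =
      emeasure (distr (lborel \<Otimes>\<^sub>M lborel) (lborel \<Otimes>\<^sub>M lborel) (\<lambda>(x, y). (y, x))) E"
    using lborel_pair.distr_pair_swap by (metis lborel_prod)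
  also have "(\<lambda>(x, y). (y, x)) = (prod.swap :: real \<times> real \<Rightarrow> _)"
    by auto
  also have "emeasure (distr (lborel \<Otimes>\<^sub>M lborel) (lborel \<Otimes>\<^sub>M lborel) prod.swap) E =
      emeasure lborel (prod.swap -` E)"
    using swap E by (simp add: lborel_prod emeasure_distr)
  finally show "emeasure lborel (prod.swap -` E) = emeasure lborel E" ..
qed

text \<open>Continuity from below along the unions of initial segments of an enumeration; since
  \<open>v\<close> is strictly smaller than the limit, some finite stage already exceeds it.\<close>

lemma finite_subfamily_measure_Union:
  assumes "countable \<S>" and sets: "\<S> \<subseteq> sets M"
    and fin: "emeasure M (\<Union>\<S>) \<noteq> \<infinity>" and v: "v < measure M (\<Union>\<S>)"
  obtains F where "finite F" "F \<subseteq> \<S>" "v < measure M (\<Union>F)"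
proof (cases "\<S> = {}")
  \<comment> \<open>The empty family is treated apart, since an enumeration needs a member to
    list.\<close>
  case True
  then show ?thesis using v that[of "{}"] by simp
next
  case False
  define A where "A = (\<lambda>n. \<Union>(from_nat_into \<S> ` {..n}))"
  have range: "from_nat_into \<S> ` UNIV = \<S>"
    using False \<open>countable \<S>\<close> by (rule range_from_nat_into)
  have "(\<Union>n. A n) = \<Union>(range (from_nat_into \<S>))"
    by (auto simp: A_def)
  then have UN_A: "(\<Union>n. A n) = \<Union>\<S>"
    by (simp only: range)
  have sub: "from_nat_into \<S> ` {..n} \<subseteq> \<S>" for n
    using range by auto
  have "A n \<in> sets M" for n
    unfolding A_def using sub sets by (intro sets.finite_Union) auto
  moreover have "incseq A"
    by (force simp: incseq_def A_def)
  ultimately have "(\<lambda>n. measure M (A n)) \<longlonglongrightarrow> measure M (\<Union>\<S>)"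
    using Lim_measure_incseq[of A M] fin by (auto simp: UN_A)
  then have "eventually (\<lambda>n. v < measure M (A n)) sequentially"
    using v by (rule order_tendstoD)
  then obtain n where "v < measure M (A n)"
    by (auto simp: eventually_sequentially)
  then show ?thesis
    using that[of "from_nat_into \<S> ` {..n}"] sub by (simp add: A_def)
qed

lemma null_sets_vertical_line: "{c} \<times> UNIV \<in> null_sets (lborel :: (real \<times> real) measure)"
proof -
  have "emeasure (lborel \<Otimes>\<^sub>M lborel) ({c} \<times> (UNIV :: real set)) = 0"
    by (subst lborel.emeasure_pair_measure_Times) auto
  moreover have "closed ({c} \<times> (UNIV :: real set))"
    by (intro closed_Times) auto
  ultimately show ?thesis
    by (simp add: null_sets_def lborel_prod)
qed

section \<open>Finite families of squares\<close>

lemma closed_is_aligned_square: "is_aligned_square S \<Longrightarrow> closed S"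
  by (auto simp: is_aligned_square_def aligned_square_def intro!: closed_Times)

text \<open>The upper left corner is the one closest to crossing the diagonal; the lower right
  corner gives the other two bounds.\<close>

lemma aligned_square_subset_lower_triangleD:
  assumes "0 < l" and "aligned_square a b l \<subseteq> lower_triangle"
  shows "b + l \<le> a" "0 \<le> b" "a + l \<le> 1"
proof -
  have "(a, b + l) \<in> aligned_square a b l" "(a + l, b) \<in> aligned_square a b l"
    using assms(1) by (auto simp: aligned_square_def)
  then show "b + l \<le> a" "0 \<le> b" "a + l \<le> 1"
    using assms(2) by (auto simp: lower_triangle_def)
qed

text \<open>Each square joins its horizontal projection to its vertical one. Reflecting in the
  diagonal makes the relation symmetric and doubles the covered area, so the uncovered pairs of the
  unit square have measure at most \<open>1 - 2 * measure lborel (\<Union>F)\<close>.\<close>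

lemma finite_squares_lower_bound:
  assumes F: "finite F"
    and square: "\<And>S. S \<in> F \<Longrightarrow> is_aligned_square S"
    and subset: "\<And>S. S \<in> F \<Longrightarrow> S \<subseteq> lower_triangle"
    and K: "1 - 2 * measure lborel (\<Union>F) < K"
  shows "- ln K \<le> 2 * ln 2 * (\<Sum>S\<in>F. side_length S)"
proof -
  have "\<forall>S\<in>F. \<exists>a b l. 0 < l \<and> S = aligned_square a b l"
    using square by (auto simp: is_aligned_square_def)
  then obtain a b l where l: "\<And>S. S \<in> F \<Longrightarrow> 0 < l S"
    and S: "\<And>S. S \<in> F \<Longrightarrow> S = aligned_square (a S) (b S) (l S)"
    by metis
  have side: "side_length S = l S" if "S \<in> F" for S
    using side_length_aligned_square[OF l[OF that]] S[OF that] by metis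
  have pos: "b S + l S \<le> a S" "0 \<le> b S" "a S + l S \<le> 1" if "S \<in> F" for S
    using aligned_square_subset_lower_triangleD[of "l S" "a S" "b S"] l[OF that] S[OF that]
      subset[OF that] by auto

  let ?Z = "{0..1} :: real set"
  define M where "M = restrict_space lborel ?Z"
  interpret prob_space M
    unfolding M_def by (rule prob_space_restrict_space) auto
  interpret P: pair_prob_space M M ..
  have space_M: "space M = ?Z"
    by (simp add: M_def space_restrict_space)
  have em_pair: "emeasure (M \<Otimes>\<^sub>M M) E = emeasure lborel E"
    if "E \<in> sets borel" "E \<subseteq> ?Z \<times> ?Z" for E
    using emeasure_pair_restrict_lborel[OF that(1) _ that(2)] sigma_finite_measure_axioms
    by (simp add: M_def)

  \<comment> \<open>Dropping the left edges makes the two sides of every square disjoint.\<close>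
  define A where "A = (\<lambda>S. {a S<..a S + l S})"
  define B where "B = (\<lambda>S. {b S..b S + l S})"
  define U where "U = (\<Union>S\<in>F. A S \<times> B S)"
  have AB_sub: "A S \<subseteq> ?Z" "B S \<subseteq> ?Z" if "S \<in> F" for S
    using pos[OF that] l[OF that] by (auto simp: A_def B_def)
  \<comment> \<open>Without the left edge, \<open>a S < x\<close>, while
    \<open>y \<le> b S + l S \<le> a S\<close>. The strict inequality keeps \<open>U\<close>
    disjoint from its mirror image.\<close>
  have below: "y < x" if "(x, y) \<in> U" for x y
    using that pos by (fastforce simp: U_def A_def B_def)
  have U_borel: "U \<in> sets borel"
    unfolding U_def borel_prod[symmetric] using F
    by (intro sets.finite_UN pair_measureI) (auto simp: A_def B_def)
  have U_sub: "U \<subseteq> ?Z \<times> ?Z"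
    using AB_sub by (fastforce simp: U_def)
  note swap_borel = sets_swap_borel[OF U_borel]
  have swap_sub: "prod.swap -` U \<subseteq> ?Z \<times> ?Z"
    using U_sub by auto
  have fin: "emeasure lborel U \<noteq> \<infinity>"
    using em_pair[OF U_borel U_sub] P.emeasure_finite[of U] by simp

  have "measure lborel (\<Union>F) \<le> measure lborel U"
  proof -
    \<comment> \<open>These finitely many null lines contain the dropped left edges.\<close>
    let ?L = "\<Union>S\<in>F. {a S} \<times> (UNIV :: real set)"
    have L: "?L \<in> null_sets lborel"
      using F by (intro null_sets.finite_UN null_sets_vertical_line) auto
    have "\<Union>F \<subseteq> U \<union> ?L"
    proof
      fix p assume "p \<in> \<Union>F"
      then obtain S where "S \<in> F" "p \<in> aligned_square (a S) (b S) (l S)"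
        using S by blast
      then show "p \<in> U \<union> ?L"
        by (cases p) (force simp: aligned_square_def U_def A_def B_def)
    qed
    then have "emeasure lborel (\<Union>F) \<le> emeasure lborel (U \<union> ?L)"
      using U_borel L by (intro emeasure_mono) auto
    also have "\<dots> = emeasure lborel U"
      using U_borel L by (intro emeasure_Un_null_set) auto
    finally show ?thesis
      using fin by (simp add: measure_def enn2real_mono top.not_eq_extremum)
  qed
  moreover have "measure lborel (U \<union> prod.swap -` U) = 2 * measure lborel U"
  proof -
    have "U \<inter> prod.swap -` U = {}"
      by (auto dest!: below)
    then show ?thesis
      using fin U_borel swap_borel emeasure_swap_lborel[OF U_borel]
      by (subst measure_Union) (auto simp: measure_def)
  qed
  ultimately have D: "1 - measure lborel (U \<union> prod.swap -` U) < K"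
    using K by simp

  let ?D = "U \<union> prod.swap -` U"
  have D_sets: "?D \<in> sets (M \<Otimes>\<^sub>M M)"
    unfolding M_def using U_borel swap_borel U_sub swap_sub
    by (intro sets_pair_restrict_lborel) auto
  have "measure (M \<Otimes>\<^sub>M M) ?D = measure lborel ?D"
    using em_pair[of ?D] U_borel swap_borel U_sub swap_sub by (simp add: measure_def)
  then have W: "measure (M \<Otimes>\<^sub>M M) (space (M \<Otimes>\<^sub>M M) - ?D) < K"
    using P.prob_compl[OF D_sets] D by simp
  have "- ln K \<le> ln 2 * (\<Sum>S\<in>F. prob (A S) + prob (B S))"
  proof (rule biclique_cover_lower_bound[OF F _ _ _ _ _ W])
    show "A S \<in> events" "B S \<in> events" if "S \<in> F" for S
      using AB_sub[OF that] by (auto simp: M_def sets_restrict_space_iff A_def B_def)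
    show "A S \<inter> B S = {}" if "S \<in> F" for S
      using pos[OF that] by (auto simp: A_def B_def)
    show "space (M \<Otimes>\<^sub>M M) - ?D \<in> P.events"
      using D_sets by auto
    show "(x, y) \<in> space (M \<Otimes>\<^sub>M M) - ?D"
      if "x \<in> space M" "y \<in> space M"
        "\<And>S. S \<in> F \<Longrightarrow> \<not> (x \<in> A S \<and> y \<in> B S) \<and> \<not> (x \<in> B S \<and> y \<in> A S)" for x y
      using that by (auto simp: space_pair_measure U_def)
  qed
  \<comment> \<open>Both projections of a square have its side length, whence the factor 2.\<close>
  also have "(\<Sum>S\<in>F. prob (A S) + prob (B S)) = (\<Sum>S\<in>F. 2 * side_length S)"
  proof (rule sum.cong[OF refl])
    fix S assume SF: "S \<in> F"
    have "prob (A S) = measure lborel (A S)" "prob (B S) = measure lborel (B S)"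
      unfolding M_def using AB_sub[OF SF] by (auto intro!: measure_restrict_space)
    then show "prob (A S) + prob (B S) = 2 * side_length S"
      using l[OF SF] side[OF SF] by (simp add: A_def B_def)
  qed
  finally show ?thesis
    by (simp add: sum_distrib_left[symmetric])
qed

section \<open>The measure of the triangle\<close>

lemma closed_lower_triangle: "closed lower_triangle"
proof -
  have "lower_triangle = {p. 0 \<le> fst p} \<inter> {p. fst p \<le> 1} \<inter> {p. 0 \<le> snd p} \<inter> {p. snd p \<le> fst p}"
    by (auto simp: lower_triangle_def)
  moreover have "closed \<dots>"
    by (intro closed_Int closed_Collect_le continuous_intros)
  ultimately show ?thesis by simp
qed

lemma lower_triangle_subset_cbox: "lower_triangle \<subseteq> cbox (0, 0) (1, 1)"
  by (auto simp: lower_triangle_def cbox_Pair_eq)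

lemma emeasure_lower_triangle_finite: "emeasure lborel lower_triangle \<noteq> \<infinity>"
  using emeasure_mono[OF lower_triangle_subset_cbox, of lborel]
    emeasure_lborel_cbox_finite[of "(0, 0) :: real \<times> real" "(1, 1)"]
  by (auto simp: top_unique)

text \<open>The triangle and its mirror image have equal measure and together cover the unit
  square.\<close>

lemma measure_lower_triangle_ge: "1 / 2 \<le> measure lborel lower_triangle"
proof -
  have T: "lower_triangle \<in> sets borel"
    using closed_lower_triangle by simp
  have "1 = emeasure (lborel \<Otimes>\<^sub>M lborel) ({0..1 :: real} \<times> {0..1 :: real})"
    by (subst lborel.emeasure_pair_measure_Times) auto
  also have "\<dots> \<le> emeasure lborel (lower_triangle \<union> prod.swap -` lower_triangle)"
    unfolding lborel_prod using T sets_swap_borel[OF T]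
    by (intro emeasure_mono) (auto simp: lower_triangle_def)
  also have "\<dots> \<le> emeasure lborel lower_triangle + emeasure lborel (prod.swap -` lower_triangle)"
    using T sets_swap_borel[OF T] by (intro emeasure_subadditive) auto
  also have "\<dots> = ennreal (2 * measure lborel lower_triangle)"
    using emeasure_lower_triangle_finite
    by (simp add: emeasure_swap_lborel[OF T] emeasure_eq_ennreal_measure ennreal_plus[symmetric]
        del: ennreal_plus)
  finally show ?thesis
    by (simp add: ennreal_1[symmetric] del: ennreal_1)
qed

section \<open>Countable families of squares\<close>

text \<open>For \<open>K = 2 powr (- 2 * r)\<close> one has \<open>- ln K = 2 * r * ln 2\<close>, so
  the finite bound reads \<open>r \<le> (\<Sum>S\<in>F. side_length S)\<close>. The gap between
  \<open>\<epsilon>\<close> and \<open>K\<close> makes room for passing to a finite subfamily. The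
  value \<open>\<epsilon> = 0\<close> is allowed and serves the case of almost full
  coverage.\<close>

lemma finite_subfamily_sum_side_length:
  fixes \<S> :: "(real \<times> real) set set"
  assumes "countable \<S>"
    and square: "\<And>S. S \<in> \<S> \<Longrightarrow> is_aligned_square S"
    and subset: "\<And>S. S \<in> \<S> \<Longrightarrow> S \<subseteq> lower_triangle"
    and m: "(1 - \<epsilon>) / 2 \<le> measure lebesgue (\<Union>\<S>)" and r: "\<epsilon> < 2 powr (- 2 * r)"
  obtains F where "finite F" "F \<subseteq> \<S>" "r \<le> (\<Sum>S\<in>F. side_length S)"
proof -
  have borel: "\<S> \<subseteq> sets lborel"
    using square by (auto intro!: borel_closed closed_is_aligned_square)
  have Union: "\<Union>\<S> \<in> sets lborel"
    using \<open>countable \<S>\<close> borel by (intro sets.countable_Union) auto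
  have "emeasure lborel (\<Union>\<S>) \<le> emeasure lborel lower_triangle"
    using subset closed_lower_triangle by (intro emeasure_mono) auto
  then have fin: "emeasure lborel (\<Union>\<S>) \<noteq> \<infinity>"
    using emeasure_lower_triangle_finite by (auto simp: top_unique)
  \<comment> \<open>The union is Borel, so its completed measure is its \<open>lborel\<close>
    measure.\<close>
  have "(1 - 2 powr (- 2 * r)) / 2 < measure lborel (\<Union>\<S>)"
    using m r Union by (simp add: measure_completion)
  from finite_subfamily_measure_Union[OF \<open>countable \<S>\<close> borel fin this]
  obtain F where F: "finite F" "F \<subseteq> \<S>" "(1 - 2 powr (- 2 * r)) / 2 < measure lborel (\<Union>F)" .
  have "- ln (2 powr (- 2 * r)) \<le> 2 * ln 2 * (\<Sum>S\<in>F. side_length S)"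
    using F square subset by (intro finite_squares_lower_bound) (auto simp: field_simps)
  then have "r \<le> (\<Sum>S\<in>F. side_length S)"
    by (simp add: ln_powr)
  with F show ?thesis using that by blast
qed

theorem theorem5p2:
  fixes \<S> :: "(real \<times> real) set set"
  assumes "countable \<S>"
    and "\<And>S. S \<in> \<S> \<Longrightarrow> is_aligned_square S"
    and "\<And>S. S \<in> \<S> \<Longrightarrow> S \<subseteq> lower_triangle"
  shows "(\<forall>\<epsilon>::real. \<epsilon> > 0 \<longrightarrow> measure lebesgue (\<Union>\<S>) \<ge> (1 - \<epsilon>) / 2 \<longrightarrow>
            (\<Sum>\<^sub>\<infinity>S\<in>\<S>. ereal (side_length S)) \<ge> ereal (1 / 2 * log 2 (1 / \<epsilon>))) \<and>
         (lower_triangle - \<Union>\<S> \<in> null_sets lebesgue \<longrightarrow> \<not> side_length summable_on \<S>)"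
proof (intro conjI allI impI)
  have side_nonneg: "0 \<le> side_length S" if "S \<in> \<S>" for S
    using assms(2)[OF that] side_length_aligned_square by (fastforce simp: is_aligned_square_def)
  {
    fix \<epsilon> :: real
    assume \<epsilon>: "0 < \<epsilon>" and m: "measure lebesgue (\<Union>\<S>) \<ge> (1 - \<epsilon>) / 2"
    \<comment> \<open>Finite subfamilies only reach values strictly below the target, so the bound
      is shown for each smaller \<open>r\<close> and \<open>dense_le\<close> supplies the
      endpoint.\<close>
    have below: "ereal r \<le> (\<Sum>\<^sub>\<infinity>S\<in>\<S>. ereal (side_length S))"
      if r: "r < 1 / 2 * log 2 (1 / \<epsilon>)" for r
    proof -
      have "log 2 \<epsilon> < - 2 * r"
        using r \<epsilon> by (simp add: log_divide)
      then have "\<epsilon> < 2 powr (- 2 * r)"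
        using \<epsilon> by (simp add: log_less_iff)
      from finite_subfamily_sum_side_length[OF assms m this]
      obtain F where F: "finite F" "F \<subseteq> \<S>" "r \<le> (\<Sum>S\<in>F. side_length S)" .
      have "ereal r \<le> (\<Sum>S\<in>F. ereal (side_length S))"
        using F(3) by simp
      \<comment> \<open>For nonnegative terms the extended sum is the supremum of the finite sums,
        also when it is infinite.\<close>
      also have "\<dots> \<le> (\<Sum>\<^sub>\<infinity>S\<in>\<S>. ereal (side_length S))"
        using F side_nonneg
        by (subst nonneg_infsum_complete) (auto intro!: SUP_upper)
      finally show ?thesis .
    qed
    show "ereal (1 / 2 * log 2 (1 / \<epsilon>)) \<le> (\<Sum>\<^sub>\<infinity>S\<in>\<S>. ereal (side_length S))"
    proof (rule dense_le)
      fix z assume z: "z < ereal (1 / 2 * log 2 (1 / \<epsilon>))"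
      then show "z \<le> (\<Sum>\<^sub>\<infinity>S\<in>\<S>. ereal (side_length S))"
        using below by (cases z) auto
    qed
  next
    assume null: "lower_triangle - \<Union>\<S> \<in> null_sets lebesgue"
    show "\<not> side_length summable_on \<S>"
    proof
      assume summable: "side_length summable_on \<S>"
      \<comment> \<open>A finite sum reaching \<open>r\<close> would exceed the supposed
        total.\<close>
      define r where "r = infsum side_length \<S> + 1"
      have Union: "\<Union>\<S> \<in> sets lborel"
        using \<open>countable \<S>\<close> assms(2)
        by (intro sets.countable_Union) (auto intro!: borel_closed closed_is_aligned_square)
      have "\<Union>\<S> \<union> (lower_triangle - \<Union>\<S>) = lower_triangle"
        using assms(3) by auto
      then have "emeasure lebesgue (\<Union>\<S>) = emeasure lebesgue lower_triangle"
        using emeasure_Un_null_set[OF _ null, of "\<Union>\<S>"] Union by auto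
      then have "measure lebesgue (\<Union>\<S>) = measure lborel lower_triangle"
        using closed_lower_triangle by (simp add: measure_def)
      \<comment> \<open>This is the coverage hypothesis at \<open>\<epsilon> = 0\<close>; as
        \<open>0 < 2 powr (- 2 * r)\<close> for every \<open>r\<close>, finite sums become
        arbitrarily large.\<close>
      then have "(1 - 0) / 2 \<le> measure lebesgue (\<Union>\<S>)"
        using measure_lower_triangle_ge by simp
      from finite_subfamily_sum_side_length[OF assms this, of r]
      obtain F where "finite F" "F \<subseteq> \<S>" "r \<le> (\<Sum>S\<in>F. side_length S)"
        by auto
      moreover from this have "(\<Sum>S\<in>F. side_length S) \<le> infsum side_length \<S>"
        using side_nonneg by (intro finite_sum_le_infsum summable) auto
      ultimately show False
        by (simp add: r_def)
    qed
  }
qed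

end
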